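(* For each $n\in\mathbb{N}_0$ let $\{Q_{k,n}:0\le k\le n\}$ be a basis of $\mathcal{V}_n^2(W,\mathbb{C})$, with associated column vector $\mathbb{Q}_n=(Q_{0,n},\ldots,Q_{n,n})^{\mathsf t}$, satisfying $\mathbb{Q}_n(z,\bar z)=J_{n+1}\overline{\mathbb{Q}_n(z,\bar z)}$, and with $\mathbb{Q}_0=1$, $\mathbb{Q}_{-1}=0$. Then there are complex matrices $\alpha_n$ of size $(n+1)\times(n+2)$, $\beta_n$ of size $(n+1)\times(n+1)$, and $\gamma_{n-1}$ of size $(n+1)\times n$ such that, for all $n\ge 0$, $$z\,\mathbb{Q}_n(z,\bar z)=\alpha_n\mathbb{Q}_{n+1}(z,\bar z)+\beta_n\mathbb{Q}_n(z,\bar z)+\gamma_{n-1}\mathbb{Q}_{n-1}(z,\bar z),$$ where, setting $H_n=\int_\Omega \mathbb{Q}_n(z,\bar z)\,\mathbb{Q}_n(z,\bar z)^*\,w(z)\,dx\,dy$, the matrices satisfy, for $n\ge1$, $$\gamma_{n-1}H_{n-1}=J_{n+1}(\alpha_{n-1}H_n)^{\mathsf t}J_n .$$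
   Context: Let $\Omega\subset\mathbb{R}^2$ and let $W$ be a nonnegative weight function on $\Omega$ such that all moments are finite, $\int_\Omega W\,dx\,dy=1$, and $\int_\Omega p^2W\,dx\,dy>0$ for every nonzero real polynomial $p$ in $x,y$. Identify $\mathbb{R}^2$ with $\mathbb{C}$ via $z=x+iy$ and put $w(z)=W(x,y)$. $\Pi_n^2(\mathbb{C})$ is the space of polynomials in $z,\bar z$ with complex coefficients of total degree at most $n$ ($\Pi_{-1}^2(\mathbb{C})=\{0\}$), $\langle f,g\rangle_W^{\mathbb{C}}=\int_\Omega f(z,\bar z)\overline{g(z,\bar z)}w(z)\,dx\,dy$, and $\mathcal{V}_n^2(W,\mathbb{C})=\{P\in\Pi_n^2(\mathbb{C}):\langle P,Q\rangle_W^{\mathbb{C}}=0\ \forall Q\in\Pi_{n-1}^2(\mathbb{C})\}$, which has complex dimension $n+1$. $J_n$ is the $n\times n$ backward identity matrix (ones on the antidiagonal, zeros elsewhere); $\mathsf t$ denotes transpose (no conjugation), $*$ denotes conjugate transpose, and the overline is entrywise complex conjugation. *)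

theory Defs
  imports "HOL-Analysis.Analysis" "HOL-Library.Function_Algebras" "Jordan_Normal_Form.Matrix"
begin

text \<open>
  Polynomials in \<open>z\<close> and its conjugate are represented as functions on the complex plane; since
  the plane is infinite in both real directions, formal polynomials and polynomial functions
  correspond bijectively.
\<close>

definition cfscale :: "complex \<Rightarrow> (complex \<Rightarrow> complex) \<Rightarrow> complex \<Rightarrow> complex"
  where "cfscale c f = (\<lambda>z. c * f z)"

interpretation cfun: vector_space cfscale
  by unfold_locales (auto simp: cfscale_def fun_eq_iff algebra_simps)

text \<open>The degree bound is an integer so that the bound \<open>-1\<close> yields the span of the empty set,
  i.e. the zero space.\<close>

definition PiC :: "int \<Rightarrow> (complex \<Rightarrow> complex) set"
  where "PiC m = cfun.span {f. \<exists>i j. int (i + j) \<le> m \<and> f = (\<lambda>z. z ^ i * cnj z ^ j)}"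

text \<open>
  The second conjunct (finiteness of all moments) includes measurability of \<open>W\<close> on \<open>\<Omega>\<close>.
  The library's real polynomial functions on \<open>real \<times> real\<close> are the functions generated by
  constants and linear forms under sum and product, i.e. the real polynomials in \<open>x, y\<close>.
\<close>

definition admissible_weight :: "(real \<times> real) set \<Rightarrow> (real \<times> real \<Rightarrow> real) \<Rightarrow> bool"
  where "admissible_weight \<Omega> W \<longleftrightarrow>
    (\<forall>v\<in>\<Omega>. 0 \<le> W v) \<and>
    (\<forall>i j. set_integrable lebesgue \<Omega> (\<lambda>v. fst v ^ i * snd v ^ j * W v)) \<and>
    (LINT v:\<Omega>|lebesgue. W v) = 1 \<and>
    (\<forall>p. real_polynomial_function p \<and> p \<noteq> (\<lambda>_. 0) \<longrightarrow> 0 < (LINT v:\<Omega>|lebesgue. (p v)\<^sup>2 * W v))"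

definition ipC :: "(real \<times> real) set \<Rightarrow> (real \<times> real \<Rightarrow> real)
    \<Rightarrow> (complex \<Rightarrow> complex) \<Rightarrow> (complex \<Rightarrow> complex) \<Rightarrow> complex"
  where "ipC \<Omega> W f g = (LINT v:\<Omega>|lebesgue.
    f (Complex (fst v) (snd v)) * cnj (g (Complex (fst v) (snd v))) * complex_of_real (W v))"

definition VC :: "(real \<times> real) set \<Rightarrow> (real \<times> real \<Rightarrow> real) \<Rightarrow> nat \<Rightarrow> (complex \<Rightarrow> complex) set"
  where "VC \<Omega> W n = {P \<in> PiC (int n). \<forall>R \<in> PiC (int n - 1). ipC \<Omega> W P R = 0}"

definition basis_family :: "nat \<Rightarrow> (nat \<Rightarrow> complex \<Rightarrow> complex) \<Rightarrow> (complex \<Rightarrow> complex) set \<Rightarrow> bool"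
  where "basis_family n q V \<longleftrightarrow>
    inj_on q {0..n} \<and> cfun.independent (q ` {0..n}) \<and> cfun.span (q ` {0..n}) = V"

text \<open>The polynomial \<open>Q k n\<close> is the \<open>k\<close>-th one of degree \<open>n\<close>. For \<open>m = -1\<close> the column vector
  is the zero (empty) vector of dimension \<open>0\<close>, matching the \<open>(n+1) \<times> n\<close> size of the matrix
  multiplying it when \<open>n = 0\<close>.\<close>

definition Qvec :: "(nat \<Rightarrow> nat \<Rightarrow> complex \<Rightarrow> complex) \<Rightarrow> int \<Rightarrow> complex \<Rightarrow> complex vec"
  where "Qvec Q m z = vec (nat (m + 1)) (\<lambda>k. Q k (nat m) z)"

definition backward_id :: "nat \<Rightarrow> complex mat"
  where "backward_id n = mat n n (\<lambda>(i, j). if i + j + 1 = n then 1 else 0)"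

text \<open>The matrix-valued integral is taken entrywise; entry \<open>(i, j)\<close> of a column vector times its
  conjugate transpose is the \<open>i\<close>-th component times the conjugate of the \<open>j\<close>-th.\<close>

definition Hmat :: "(real \<times> real) set \<Rightarrow> (real \<times> real \<Rightarrow> real)
    \<Rightarrow> (nat \<Rightarrow> nat \<Rightarrow> complex \<Rightarrow> complex) \<Rightarrow> nat \<Rightarrow> complex mat"
  where "Hmat \<Omega> W Q n = mat (n + 1) (n + 1) (\<lambda>(i, j). ipC \<Omega> W (Q i n) (Q j n))"

end

theory Submission
  imports Defs
begin

text \<open>
  The adjoint of multiplication by \<open>z\<close> for the weighted inner product is multiplication by the
  conjugate of \<open>z\<close>, and both raise the total degree by at most one. If \<open>P\<close> lies in the \<open>n\<close>-th
  orthogonal space, then \<open>z P\<close> has degree at most \<open>n + 1\<close>, and it is orthogonal to every \<open>R\<close> of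
  degree at most \<open>n - 2\<close>, since the pairing moves \<open>z\<close> onto \<open>R\<close> and the result still has degree
  below \<open>n\<close>. The weight makes the inner product positive definite on polynomials, so orthogonal
  projections onto spaces of bounded degree exist (lemma \<open>orthogonal_projection\<close>) and the top
  degrees of \<open>z P\<close> can be split off one after the other (\<open>peel_top_degree\<close>). After three
  splittings the remainder has degree at most \<open>n - 2\<close> and is orthogonal to itself, so it is zero
  (\<open>three_term_entry\<close>).

  For the relation between the coefficient matrices, pair the expansion of \<open>z Q\<^sub>i\<^sub>,\<^sub>n\<close> with
  \<open>Q\<^sub>j\<^sub>,\<^sub>n\<^sub>-\<^sub>1\<close>. Orthogonality keeps only the lowest term, so these pairings are the entries of
  \<open>\<gamma>\<^sub>n\<^sub>-\<^sub>1 H\<^sub>n\<^sub>-\<^sub>1\<close>; in the same way the pairings of \<open>z Q\<^sub>i\<^sub>,\<^sub>n\<^sub>-\<^sub>1\<close> with \<open>Q\<^sub>j\<^sub>,\<^sub>n\<close> are the entries of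
  \<open>\<alpha>\<^sub>n\<^sub>-\<^sub>1 H\<^sub>n\<close>. Under the integral both products have the shape of \<open>z\<close> times a polynomial times a
  conjugated polynomial. The symmetry \<open>Q\<^sub>k\<^sub>,\<^sub>n = cnj Q\<^sub>n\<^sub>-\<^sub>k\<^sub>,\<^sub>n\<close> exchanges the two factors, which
  transposes the matrix and reverses both of its indices; this is what the transpose between
  two backward identities expresses (\<open>backward_id_conjugate\<close>).
\<close>

section \<open>Polynomials in a complex variable and its conjugate\<close>

text \<open>
  The conditions on the weight speak of real polynomials in \<open>x, y\<close>. The functions whose real and
  imaginary parts are of this kind contain all polynomials in \<open>z\<close> and its conjugate, and their
  closure under products makes integrability a matter of moments.
\<close>

definition polynomial_parts :: "(complex \<Rightarrow> complex) \<Rightarrow> bool"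
  where "polynomial_parts f \<longleftrightarrow>
    real_polynomial_function (\<lambda>v::real \<times> real. Re (f (Complex (fst v) (snd v)))) \<and>
    real_polynomial_function (\<lambda>v::real \<times> real. Im (f (Complex (fst v) (snd v))))"

lemma polynomial_parts_const: "polynomial_parts (\<lambda>z. c)"
  by (auto simp: polynomial_parts_def)

lemma polynomial_parts_id: "polynomial_parts (\<lambda>z. z)"
  by (auto simp: polynomial_parts_def bounded_linear_fst bounded_linear_snd)

lemma polynomial_parts_add:
  "polynomial_parts f \<Longrightarrow> polynomial_parts g \<Longrightarrow> polynomial_parts (\<lambda>z. f z + g z)"
  unfolding polynomial_parts_def plus_complex.sel
  by (intro conjI real_polynomial_function.intros(3)) auto

lemma polynomial_parts_mult:
  "polynomial_parts f \<Longrightarrow> polynomial_parts g \<Longrightarrow> polynomial_parts (\<lambda>z. f z * g z)"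
  unfolding polynomial_parts_def times_complex.sel
  by (intro conjI real_polynomial_function.intros(3,4) real_polynomial_function_diff) auto

lemma polynomial_parts_cnj: "polynomial_parts f \<Longrightarrow> polynomial_parts (\<lambda>z. cnj (f z))"
  unfolding polynomial_parts_def cnj.sel
  by (auto intro: real_polynomial_function_minus)

lemma polynomial_parts_power: "polynomial_parts f \<Longrightarrow> polynomial_parts (\<lambda>z. f z ^ n)"
  by (induction n) (auto intro: polynomial_parts_const polynomial_parts_mult)

lemma polynomial_parts_sum:
  "(\<And>k. k \<in> A \<Longrightarrow> polynomial_parts (f k)) \<Longrightarrow> polynomial_parts (\<lambda>z. \<Sum>k\<in>A. f k z)"
  by (induction A rule: infinite_finite_induct)
     (auto intro: polynomial_parts_const polynomial_parts_add)

lemma subspace_polynomial_parts: "cfun.subspace {f. polynomial_parts f}"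
proof -
  have "polynomial_parts 0"
    using polynomial_parts_const[of 0] by (simp add: zero_fun_def)
  moreover have "polynomial_parts (f + g)" if "polynomial_parts f" "polynomial_parts g" for f g
    using polynomial_parts_add[OF that] by (simp add: plus_fun_def)
  moreover have "polynomial_parts (cfscale c f)" if "polynomial_parts f" for c f
    using polynomial_parts_mult[OF polynomial_parts_const[of c] that] by (simp add: cfscale_def)
  ultimately show ?thesis by (simp add: cfun.subspace_def)
qed

lemma PiC_polynomial_parts: assumes "f \<in> PiC m" shows "polynomial_parts f"
proof -
  have "PiC m \<subseteq> {f. polynomial_parts f}"
    unfolding PiC_def
    by (rule cfun.span_minimal[OF _ subspace_polynomial_parts])
       (auto intro!: polynomial_parts_mult polynomial_parts_power polynomial_parts_cnj
          polynomial_parts_id)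
  then show ?thesis using assms by auto
qed

lemma subspace_PiC: "cfun.subspace (PiC m)"
  by (simp add: PiC_def)

lemma PiC_mono: "m \<le> n \<Longrightarrow> PiC m \<subseteq> PiC n"
  unfolding PiC_def by (rule cfun.span_mono) (blast intro: order_trans)

lemma PiC_negative: assumes "m < 0" shows "PiC m = {0}"
proof -
  have "{f. \<exists>i j. int (i + j) \<le> m \<and> f = (\<lambda>z. z ^ i * cnj z ^ j)} = {}"
    using assms by auto
  then show ?thesis by (simp only: PiC_def cfun.span_empty)
qed

lemma PiC_finitely_generated:
  obtains S where "finite S" "PiC m = cfun.span S"
proof
  let ?S = "{f. \<exists>i j. int (i + j) \<le> m \<and> f = (\<lambda>z. z ^ i * cnj z ^ j)}"
  have "?S \<subseteq> (\<lambda>(i, j) z. z ^ i * cnj z ^ j) ` ({..nat m} \<times> {..nat m})"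
  proof
    fix f assume "f \<in> ?S"
    then obtain i j where "int (i + j) \<le> m" "f = (\<lambda>z. z ^ i * cnj z ^ j)" by blast
    then show "f \<in> (\<lambda>(i, j) z. z ^ i * cnj z ^ j) ` ({..nat m} \<times> {..nat m})"
      by (intro image_eqI[of _ _ "(i, j)"]) auto
  qed
  then show "finite ?S" by (rule finite_subset) simp
  show "PiC m = cfun.span ?S" by (rule PiC_def)
qed

text \<open>Multiplication by a fixed function is linear, so a degree bound for it has to be checked on
  the spanning monomials only.\<close>

lemma PiC_multiply:
  assumes monomial: "\<And>i j. int (i + j) \<le> m \<Longrightarrow> (\<lambda>z. h z * (z ^ i * cnj z ^ j)) \<in> PiC m'"
    and "f \<in> PiC m"
  shows "(\<lambda>z. h z * f z) \<in> PiC m'"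
proof -
  have "PiC m \<subseteq> {f. (\<lambda>z. h z * f z) \<in> PiC m'}"
    unfolding PiC_def[of m]
  proof (rule cfun.span_minimal)
    show "cfun.subspace {f. (\<lambda>z. h z * f z) \<in> PiC m'}"
      unfolding cfun.subspace_def
    proof (safe)
      show "(\<lambda>z. h z * 0 z) \<in> PiC m'"
        using cfun.subspace_0[OF subspace_PiC, of m'] by (simp add: zero_fun_def)
    next
      fix f g assume "(\<lambda>z. h z * f z) \<in> PiC m'" "(\<lambda>z. h z * g z) \<in> PiC m'"
      from cfun.subspace_add[OF subspace_PiC this]
      show "(\<lambda>z. h z * (f + g) z) \<in> PiC m'" by (simp add: plus_fun_def algebra_simps)
    next
      fix c f assume "(\<lambda>z. h z * f z) \<in> PiC m'"
      from cfun.subspace_scale[OF subspace_PiC this, of c]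
      show "(\<lambda>z. h z * cfscale c f z) \<in> PiC m'" by (simp add: cfscale_def algebra_simps)
    qed
  qed (use monomial in auto)
  with assms(2) show ?thesis by auto
qed

lemma PiC_monomial: "int (i + j) \<le> m \<Longrightarrow> (\<lambda>z. z ^ i * cnj z ^ j) \<in> PiC m"
  unfolding PiC_def by (rule cfun.span_base) auto

lemma PiC_times_z: assumes "f \<in> PiC m" shows "(\<lambda>z. z * f z) \<in> PiC (m + 1)"
proof (rule PiC_multiply[OF _ assms])
  show "(\<lambda>z. z * (z ^ i * cnj z ^ j)) \<in> PiC (m + 1)" if "int (i + j) \<le> m" for i j
    using PiC_monomial[of "Suc i" j "m + 1"] that by (simp add: mult.assoc)
qed

lemma PiC_times_cnj: assumes "f \<in> PiC m" shows "(\<lambda>z. cnj z * f z) \<in> PiC (m + 1)"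
proof (rule PiC_multiply[OF _ assms])
  show "(\<lambda>z. cnj z * (z ^ i * cnj z ^ j)) \<in> PiC (m + 1)" if "int (i + j) \<le> m" for i j
    using PiC_monomial[of i "Suc j" "m + 1"] that by (simp add: mult_ac)
qed


section \<open>The weighted inner product\<close>

text \<open>
  A product of two polynomials is not handled by the induction on polynomial functions if the claim
  is about \<open>p W\<close> alone. Finiteness of all moments of \<open>p g\<close>, for every \<open>g\<close> with finite moments,
  is a claim that composes: the factors are absorbed one at a time.
\<close>

lemma integrable_polynomial_weight:
  assumes "admissible_weight \<Omega> W" and "real_polynomial_function p"
  shows "set_integrable lebesgue \<Omega> (\<lambda>v. p v * W v)"
proof -
  have key: "set_integrable lebesgue \<Omega> (\<lambda>v. fst v ^ i * snd v ^ j * (p v * g v))"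
    if "real_polynomial_function p"
      and "\<And>i j. set_integrable lebesgue \<Omega> (\<lambda>v. fst v ^ i * snd v ^ j * g v)"
    for p g :: "real \<times> real \<Rightarrow> real" and i j
    using that
  proof (induction arbitrary: g i j rule: real_polynomial_function.induct)
    case (linear h)
    have h: "h v = fst v * h (1, 0) + snd v * h (0, 1)" for v
    proof -
      have "v = fst v *\<^sub>R (1, 0) + snd v *\<^sub>R (0, 1)" by (simp add: prod_eq_iff)
      then have "h v = h (fst v *\<^sub>R (1, 0) + snd v *\<^sub>R (0, 1))" by (rule arg_cong)
      then show ?thesis
        using bounded_linear.linear[OF linear(1)] by (simp only: linear_add linear_scale real_scaleR_def)
    qed
    have "set_integrable lebesgue \<Omega> (\<lambda>v. h (1, 0) * (fst v ^ Suc i * snd v ^ j * g v)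
        + h (0, 1) * (fst v ^ i * snd v ^ Suc j * g v))"
      by (intro set_integral_add set_integrable_mult_right linear)
    moreover have "(\<lambda>v. fst v ^ i * snd v ^ j * (h v * g v)) =
        (\<lambda>v. h (1, 0) * (fst v ^ Suc i * snd v ^ j * g v)
          + h (0, 1) * (fst v ^ i * snd v ^ Suc j * g v))"
      by (intro ext, subst h) (simp add: ring_distribs mult_ac)
    ultimately show ?case by simp
  next
    case (const c)
    have "set_integrable lebesgue \<Omega> (\<lambda>v. c * (fst v ^ i * snd v ^ j * g v))"
      by (intro set_integrable_mult_right const)
    then show ?case by (simp add: algebra_simps)
  next
    case (add p q)
    have "set_integrable lebesgue \<Omega> (\<lambda>v. fst v ^ i * snd v ^ j * (p v * g v)
        + fst v ^ i * snd v ^ j * (q v * g v))"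
      by (intro set_integral_add add)
    then show ?case by (simp add: algebra_simps)
  next
    case (mult p q)
    have "set_integrable lebesgue \<Omega> (\<lambda>v. fst v ^ i * snd v ^ j * (p v * (q v * g v)))"
      by (intro mult)
    then show ?case by (simp add: algebra_simps)
  qed
  show ?thesis
    using key[of p W 0 0] assms by (simp add: admissible_weight_def)
qed

lemma integrable_ipC:
  assumes "admissible_weight \<Omega> W" and "polynomial_parts f" and "polynomial_parts g"
  shows "set_integrable lebesgue \<Omega> (\<lambda>v. f (Complex (fst v) (snd v)) *
    cnj (g (Complex (fst v) (snd v))) * complex_of_real (W v))"
proof -
  have "polynomial_parts (\<lambda>z. f z * cnj (g z))"
    using assms by (intro polynomial_parts_mult polynomial_parts_cnj)
  then have re: "set_integrable lebesgue \<Omega>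
        (\<lambda>v. Re (f (Complex (fst v) (snd v)) * cnj (g (Complex (fst v) (snd v)))) * W v)"
    and im: "set_integrable lebesgue \<Omega>
        (\<lambda>v. Im (f (Complex (fst v) (snd v)) * cnj (g (Complex (fst v) (snd v)))) * W v)"
    using integrable_polynomial_weight[OF assms(1)] unfolding polynomial_parts_def by blast+
  have of_real: "set_integrable lebesgue \<Omega> (\<lambda>v. complex_of_real (g v))"
    if "set_integrable lebesgue \<Omega> g" for g
  proof -
    have "integrable lebesgue (\<lambda>v. complex_of_real (indicator \<Omega> v *\<^sub>R g v))"
      using that unfolding set_integrable_def by (rule integrable_of_real)
    then show ?thesis by (simp add: set_integrable_def scaleR_conv_of_real)
  qed
  have "set_integrable lebesgue \<Omega> (\<lambda>v.
      complex_of_real (Re (f (Complex (fst v) (snd v)) * cnj (g (Complex (fst v) (snd v)))) * W v)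
      + \<i> * complex_of_real
          (Im (f (Complex (fst v) (snd v)) * cnj (g (Complex (fst v) (snd v)))) * W v))"
    by (intro set_integral_add set_integrable_mult_right of_real re im)
  also have "(\<lambda>v.
      complex_of_real (Re (f (Complex (fst v) (snd v)) * cnj (g (Complex (fst v) (snd v)))) * W v)
      + \<i> * complex_of_real
          (Im (f (Complex (fst v) (snd v)) * cnj (g (Complex (fst v) (snd v)))) * W v)) =
      (\<lambda>v. f (Complex (fst v) (snd v)) * cnj (g (Complex (fst v) (snd v))) * complex_of_real (W v))"
    by (intro ext) (simp add: complex_eq_iff)
  finally show ?thesis .
qed

lemma ipC_cnj: "cnj (ipC \<Omega> W f g) = ipC \<Omega> W g f"
  unfolding ipC_def set_lebesgue_integral_def
  by (subst Bochner_Integration.integral_cnj[symmetric]) (simp add: mult_ac)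

lemma ipC_add_left:
  assumes "admissible_weight \<Omega> W" "polynomial_parts f" "polynomial_parts g" "polynomial_parts h"
  shows "ipC \<Omega> W (\<lambda>z. f z + g z) h = ipC \<Omega> W f h + ipC \<Omega> W g h"
  unfolding ipC_def
  using set_integral_add(2)[OF integrable_ipC[OF assms(1,2,4)] integrable_ipC[OF assms(1,3,4)]]
  by (simp add: algebra_simps)

lemma ipC_scale_left: "ipC \<Omega> W (\<lambda>z. c * f z) h = c * ipC \<Omega> W f h"
  unfolding ipC_def by (simp add: mult.assoc)

lemma ipC_diff_left:
  assumes "admissible_weight \<Omega> W" "polynomial_parts f" "polynomial_parts g" "polynomial_parts h"
  shows "ipC \<Omega> W (\<lambda>z. f z - g z) h = ipC \<Omega> W f h - ipC \<Omega> W g h"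
  using ipC_add_left[of \<Omega> W f "\<lambda>z. (-1) * g z" h] ipC_scale_left[of \<Omega> W "-1" g h] assms
  by (simp add: polynomial_parts_mult polynomial_parts_const
      polynomial_parts_mult[OF polynomial_parts_const[of "-1"], of g, simplified])

lemma ipC_sum_left:
  assumes "admissible_weight \<Omega> W" "polynomial_parts h"
    and "\<And>k. k \<in> A \<Longrightarrow> polynomial_parts (f k)"
  shows "ipC \<Omega> W (\<lambda>z. \<Sum>k\<in>A. c k * f k z) h = (\<Sum>k\<in>A. c k * ipC \<Omega> W (f k) h)"
  using assms(3)
proof (induction A rule: infinite_finite_induct)
  case (insert x A)
  then show ?case
    using assms(1,2)
    by (simp add: ipC_add_left ipC_scale_left polynomial_parts_mult polynomial_parts_const
        polynomial_parts_sum)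
qed (simp_all add: ipC_def)

lemma ipC_zero_sym: "ipC \<Omega> W f g = 0 \<longleftrightarrow> ipC \<Omega> W g f = 0"
  by (metis ipC_cnj complex_cnj_zero)

lemma subspace_orthogonal_complement:
  assumes "admissible_weight \<Omega> W" "polynomial_parts f"
  shows "cfun.subspace {g. polynomial_parts g \<and> ipC \<Omega> W f g = 0}"
  unfolding cfun.subspace_def
proof (safe)
  show "polynomial_parts 0" using cfun.subspace_0[OF subspace_polynomial_parts] by simp
  show "ipC \<Omega> W f 0 = 0" by (simp add: ipC_def)
next
  fix g h assume gh: "polynomial_parts g" "polynomial_parts h" "ipC \<Omega> W f g = 0" "ipC \<Omega> W f h = 0"
  then show "polynomial_parts (g + h)"
    using cfun.subspace_add[OF subspace_polynomial_parts] by simp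
  show "ipC \<Omega> W f (g + h) = 0"
    using gh assms ipC_add_left[of \<Omega> W g h f] ipC_zero_sym[of \<Omega> W f] by (simp add: plus_fun_def)
next
  fix c g assume g: "polynomial_parts g" "ipC \<Omega> W f g = 0"
  then show "polynomial_parts (cfscale c g)"
    using cfun.subspace_scale[OF subspace_polynomial_parts] by simp
  show "ipC \<Omega> W f (cfscale c g) = 0"
    using g ipC_scale_left[of \<Omega> W c g f] ipC_zero_sym[of \<Omega> W f] by (simp add: cfscale_def)
qed

text \<open>With \<open>f = u + \<i> v\<close> the pairing of \<open>f\<close> with itself is the sum of the weighted integrals of
  \<open>u\<^sup>2\<close> and \<open>v\<^sup>2\<close>; each is nonnegative, and positive unless the real polynomial is zero.\<close>

lemma ipC_definite:
  assumes wt: "admissible_weight \<Omega> W" and f: "polynomial_parts f" and zero: "ipC \<Omega> W f f = 0"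
  shows "f = 0"
proof -
  let ?u = "\<lambda>v::real \<times> real. Re (f (Complex (fst v) (snd v)))"
  let ?v = "\<lambda>v::real \<times> real. Im (f (Complex (fst v) (snd v)))"
  have u: "real_polynomial_function ?u" and v: "real_polynomial_function ?v"
    using f by (auto simp: polynomial_parts_def)
  have nonneg: "0 \<le> (LINT x:\<Omega>|lebesgue. (p x)\<^sup>2 * W x)" for p
    unfolding set_lebesgue_integral_def
    using wt by (intro integral_nonneg_AE) (auto simp: admissible_weight_def indicator_def)
  have int: "set_integrable lebesgue \<Omega> (\<lambda>x. (p x)\<^sup>2 * W x)" if "real_polynomial_function p" for p
    using that by (intro integrable_polynomial_weight[OF wt] real_polynomial_function_power)
  have "ipC \<Omega> W f f = (LINT x:\<Omega>|lebesgue. complex_of_real ((?u x)\<^sup>2 * W x + (?v x)\<^sup>2 * W x))"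
    unfolding ipC_def
    by (intro arg_cong[of _ _ "set_lebesgue_integral lebesgue \<Omega>"])
       (auto simp: fun_eq_iff complex_eq_iff power2_eq_square algebra_simps)
  also have "\<dots> = complex_of_real (LINT x:\<Omega>|lebesgue. (?u x)\<^sup>2 * W x + (?v x)\<^sup>2 * W x)"
    by (rule set_integral_complex_of_real)
  also have "(LINT x:\<Omega>|lebesgue. (?u x)\<^sup>2 * W x + (?v x)\<^sup>2 * W x) =
      (LINT x:\<Omega>|lebesgue. (?u x)\<^sup>2 * W x) + (LINT x:\<Omega>|lebesgue. (?v x)\<^sup>2 * W x)"
    by (intro set_integral_add int u v)
  finally have "complex_of_real ((LINT x:\<Omega>|lebesgue. (?u x)\<^sup>2 * W x)
      + (LINT x:\<Omega>|lebesgue. (?v x)\<^sup>2 * W x)) = 0"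
    unfolding zero by (rule sym)
  then have "(LINT x:\<Omega>|lebesgue. (?u x)\<^sup>2 * W x) + (LINT x:\<Omega>|lebesgue. (?v x)\<^sup>2 * W x) = 0"
    by (rule of_real_eq_0_iff[THEN iffD1])
  then have "(LINT x:\<Omega>|lebesgue. (?u x)\<^sup>2 * W x) = 0" "(LINT x:\<Omega>|lebesgue. (?v x)\<^sup>2 * W x) = 0"
    using nonneg[of ?u] nonneg[of ?v] by linarith+
  moreover have "p = (\<lambda>_. 0)"
    if "real_polynomial_function p" "(LINT x:\<Omega>|lebesgue. (p x)\<^sup>2 * W x) = 0" for p
  proof (rule ccontr)
    assume "p \<noteq> (\<lambda>_. 0)"
    with wt that(1) have "0 < (LINT x:\<Omega>|lebesgue. (p x)\<^sup>2 * W x)"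
      by (simp add: admissible_weight_def)
    with that(2) show False by simp
  qed
  ultimately have "?u = (\<lambda>_. 0)" "?v = (\<lambda>_. 0)" using u v by blast+
  then have "?u (Re z, Im z) = 0" "?v (Re z, Im z) = 0" for z by metis+
  then show ?thesis by (simp add: fun_eq_iff complex_eq_iff)
qed


section \<open>Orthogonal decomposition\<close>

text \<open>
  Gram-Schmidt, one generator at a time: the new generator \<open>a\<close> is replaced by its component \<open>b\<close>
  orthogonal to the old span, and the projection of \<open>f\<close> is corrected by the multiple of \<open>b\<close> that
  makes the residual orthogonal to \<open>b\<close>. The generators may be linearly dependent, in which case
  \<open>b\<close> can vanish.
\<close>

lemma orthogonal_projection:
  assumes wt: "admissible_weight \<Omega> W" and "finite S" and "\<And>s. s \<in> S \<Longrightarrow> polynomial_parts s"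
    and "polynomial_parts f"
  shows "\<exists>p\<in>cfun.span S. \<forall>s\<in>cfun.span S. ipC \<Omega> W (f - p) s = 0"
  using assms(2-4)
proof (induction arbitrary: f rule: finite_induct)
  case empty
  then show ?case by (auto simp: ipC_def)
next
  case (insert a S)
  note diff = cfun.subspace_diff[OF subspace_polynomial_parts, simplified]
  have span_S: "polynomial_parts s" if "s \<in> cfun.span S" for s
    using cfun.span_minimal[OF _ subspace_polynomial_parts, of S] insert.prems that by auto
  obtain p where p: "p \<in> cfun.span S" "\<forall>s\<in>cfun.span S. ipC \<Omega> W (f - p) s = 0"
    using insert.IH[of f] insert.prems by blast
  obtain q where q: "q \<in> cfun.span S" "\<forall>s\<in>cfun.span S. ipC \<Omega> W (a - q) s = 0"
    using insert.IH[of a] insert.prems by blast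
  define b where "b = a - q"
  have b: "polynomial_parts b" unfolding b_def using diff insert span_S q by simp
  have fp: "polynomial_parts (f - p)" using diff insert span_S p by simp
  \<comment> \<open>If \<open>b = 0\<close> the division below yields \<open>c = 0\<close>, which is the right coefficient.\<close>
  define c where "c = ipC \<Omega> W (f - p) b / ipC \<Omega> W b b"
  define r where "r = f - (p + cfscale c b)"
  have r: "r = (\<lambda>z. (f - p) z - c * b z)"
    by (auto simp: r_def cfscale_def fun_eq_iff)
  have r_poly: "polynomial_parts r"
    unfolding r_def
    using diff insert.prems fp b span_S[OF p(1)]
      cfun.subspace_add[OF subspace_polynomial_parts, simplified]
      cfun.subspace_scale[OF subspace_polynomial_parts, simplified] by simp
  have r_ip: "ipC \<Omega> W r s = ipC \<Omega> W (f - p) s - c * ipC \<Omega> W b s" if "polynomial_parts s" for s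
    unfolding r using ipC_diff_left[OF wt fp _ that, of "\<lambda>z. c * b z"] b
    by (simp add: ipC_scale_left polynomial_parts_mult polynomial_parts_const)
  have rb: "ipC \<Omega> W r b = 0"
  proof (cases "ipC \<Omega> W b b = 0")
    case True
    then have "b = 0" using ipC_definite[OF wt b] by simp
    then show ?thesis by (simp add: ipC_def)
  qed (use r_ip[OF b] in \<open>simp add: c_def\<close>)
  have rs: "ipC \<Omega> W r s = 0" if "s \<in> cfun.span S" for s
    using r_ip[OF span_S[OF that]] p(2) q(2) that by (simp add: b_def)
  let ?K = "{g. polynomial_parts g \<and> ipC \<Omega> W r g = 0}"
  have K: "cfun.subspace ?K" by (rule subspace_orthogonal_complement[OF wt r_poly])
  have "b + q \<in> ?K"
    using cfun.subspace_add[OF K, of b q] rb rs[OF q(1)] b span_S[OF q(1)] by simp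
  then have "a \<in> ?K" by (simp add: b_def)
  moreover have "S \<subseteq> ?K" using rs span_S cfun.span_base by blast
  ultimately have "cfun.span (insert a S) \<subseteq> ?K" using K by (intro cfun.span_minimal) auto
  moreover have "p + cfscale c b \<in> cfun.span (insert a S)"
  proof -
    have "cfun.span S \<subseteq> cfun.span (insert a S)" by (rule cfun.span_mono) auto
    then have "p \<in> cfun.span (insert a S)" "q \<in> cfun.span (insert a S)" using p(1) q(1) by auto
    moreover have "a \<in> cfun.span (insert a S)" by (rule cfun.span_base) simp
    ultimately show ?thesis
      unfolding b_def by (intro cfun.span_add cfun.span_scale cfun.span_diff)
  qed
  ultimately show ?case unfolding r_def by blast
qed

lemma basis_family_expand:
  assumes "basis_family n q V" and "P \<in> V"
  obtains a where "\<And>z. P z = (\<Sum>k<n+1. a k * q k z)"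
proof -
  have inj: "inj_on q {0..n}" and V: "P \<in> cfun.span (q ` {0..n})"
    using assms by (auto simp: basis_family_def)
  from V obtain u where "P = (\<Sum>v\<in>q ` {0..n}. cfscale (u v) v)"
    by (subst (asm) cfun.span_finite) auto
  also have "\<dots> = (\<Sum>k\<in>{0..n}. cfscale (u (q k)) (q k))"
    by (simp add: sum.reindex[OF inj])
  finally have P: "P = \<dots>" .
  have ap: "(\<Sum>k\<in>A. F k) z = (\<Sum>k\<in>A. F k z)" for A F and z :: complex
    by (induction A rule: infinite_finite_induct) auto
  have "{0..n} = {..<n+1}" by auto
  then have "P z = (\<Sum>k<n+1. u (q k) * q k z)" for z
    unfolding P by (simp add: ap cfscale_def)
  then show ?thesis by (rule that)
qed

lemma basis_family_mem:
  assumes "basis_family n q V" and "k \<le> n" shows "q k \<in> V"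
  using assms cfun.span_base by (fastforce simp: basis_family_def)

text \<open>Subtracting from \<open>F\<close> its projection onto the polynomials of lower degree leaves an element
  of the \<open>n\<close>-th orthogonal space, which the basis spans.\<close>

lemma peel_top_degree:
  assumes wt: "admissible_weight \<Omega> W"
    and basis: "basis_family n q (VC \<Omega> W n)" and F: "F \<in> PiC (int n)"
  obtains a where "(\<lambda>z. F z - (\<Sum>k<n+1. a k * q k z)) \<in> PiC (int n - 1)"
proof -
  obtain S where S: "finite S" "PiC (int n - 1) = cfun.span S"
    by (rule PiC_finitely_generated)
  then have "polynomial_parts s" if "s \<in> S" for s
    using that PiC_polynomial_parts cfun.span_base by metis
  then obtain p where p: "p \<in> PiC (int n - 1)" "\<forall>s\<in>PiC (int n - 1). ipC \<Omega> W (F - p) s = 0"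
    using orthogonal_projection[OF wt S(1) _ PiC_polynomial_parts[OF F]] S(2) by auto
  have "F - p \<in> PiC (int n)"
    using cfun.subspace_diff[OF subspace_PiC F] p(1) PiC_mono[of "int n - 1" "int n"] by auto
  then have "F - p \<in> VC \<Omega> W n" using p by (simp add: VC_def)
  then obtain a where a: "\<And>z. (F - p) z = (\<Sum>k<n+1. a k * q k z)"
    using basis_family_expand[OF basis] by blast
  have "p = (\<lambda>z. F z - (\<Sum>k<n+1. a k * q k z))"
    unfolding a[symmetric] by simp
  with p(1) that show ?thesis by metis
qed

text \<open>
  Three splittings leave a remainder of degree at most \<open>n - 2\<close>. It is orthogonal to the three
  parts split off, and to \<open>z P\<close> because multiplication by \<open>z\<close> has the conjugate multiplication as
  its adjoint; so it is orthogonal to itself. For \<open>n = 0\<close> the remainder already lies in the zero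
  space after two splittings.
\<close>

lemma three_term_entry:
  assumes wt: "admissible_weight \<Omega> W"
    and basis: "\<And>n. basis_family n (\<lambda>k. Q k n) (VC \<Omega> W n)" and P: "P \<in> VC \<Omega> W n"
  shows "\<exists>a b c. \<forall>z. z * P z = (\<Sum>k<n+2. a k * Q k (n + 1) z)
    + (\<Sum>k<n+1. b k * Q k n z) + (\<Sum>k<n. c k * Q k (n - 1) z)"
proof -
  define F where "F = (\<lambda>z. z * P z)"
  have "F \<in> PiC (int (n + 1))" using P PiC_times_z[of P "int n"] by (simp add: F_def VC_def add.commute)
  from peel_top_degree[OF wt basis this] obtain a
    where r1: "(\<lambda>z. F z - (\<Sum>k<n+2. a k * Q k (n + 1) z)) \<in> PiC (int n)" (is "?r1 \<in> _")
    by auto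
  from peel_top_degree[OF wt basis this] obtain b
    where r2: "(\<lambda>z. ?r1 z - (\<Sum>k<n+1. b k * Q k n z)) \<in> PiC (int n - 1)" (is "?r2 \<in> _")
    by blast
  show ?thesis
  proof (cases n)
    case 0
    then have zero: "?r2 = 0" using r2 PiC_negative[of "int n - 1"] by simp
    have "?r2 z = 0" for z using fun_cong[OF zero, of z] by (simp only: zero_fun_apply)
    then have "z * P z = (\<Sum>k<n+2. a k * Q k (n + 1) z)
        + (\<Sum>k<n+1. b k * Q k n z) + (\<Sum>k<n. 0 * Q k (n - 1) z)" for z
      by (simp add: F_def algebra_simps)
    then show ?thesis
      by (intro exI[of _ a] exI[of _ b] exI[of _ "\<lambda>_. 0"] allI)
  next
    case (Suc m)
    then have "?r2 \<in> PiC (int m)" using r2 by simp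
    from peel_top_degree[OF wt basis this] obtain c
      where r3: "(\<lambda>z. ?r2 z - (\<Sum>k<n. c k * Q k m z)) \<in> PiC (int m - 1)" (is "?r3 \<in> _")
      using Suc by auto
    have mem: "Q k l \<in> VC \<Omega> W l" if "k < l + 1" for k l
      using basis_family_mem[OF basis] that by simp
    have Q_poly: "polynomial_parts (Q k l)" if "k < l + 1" for k l
      using mem[OF that] PiC_polynomial_parts by (auto simp: VC_def)
    have r3p: "polynomial_parts ?r3" using r3 PiC_polynomial_parts by blast
    have orth: "ipC \<Omega> W (\<lambda>z. \<Sum>k<l+1. d k * Q k l z) ?r3 = 0" if "m \<le> l" for d l
    proof -
      have "?r3 \<in> PiC (int l - 1)" using r3 that PiC_mono[of "int m - 1" "int l - 1"] by auto
      then show ?thesis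
        using mem Q_poly by (subst ipC_sum_left[OF wt r3p]) (auto simp: VC_def)
    qed
    have "ipC \<Omega> W F ?r3 = ipC \<Omega> W P (\<lambda>z. cnj z * ?r3 z)"
      by (simp add: F_def ipC_def mult_ac)
    moreover have "(\<lambda>z. cnj z * ?r3 z) \<in> PiC (int n - 1)"
      using PiC_times_cnj[OF r3] Suc by simp
    ultimately have "ipC \<Omega> W F ?r3 = 0" using P by (simp add: VC_def)
    moreover have Fp: "polynomial_parts F"
      using \<open>F \<in> PiC (int (n + 1))\<close> PiC_polynomial_parts by blast
    moreover have sp: "polynomial_parts (\<lambda>z. \<Sum>k<l+1. d k * Q k l z)" for d l
      by (intro polynomial_parts_sum polynomial_parts_mult polynomial_parts_const Q_poly) simp
    ultimately have "ipC \<Omega> W ?r3 ?r3 = 0"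
      using orth[of "n + 1" a] orth[of n b] orth[of m c] Suc r3p PiC_polynomial_parts[OF r1]
        PiC_polynomial_parts[OF r2] sp[of a "n + 1"] sp[of b n] sp[of c m]
      by (simp add: ipC_diff_left[OF wt] )
    then have zero: "?r3 = 0" using ipC_definite[OF wt r3p] by blast
    have "?r3 z = 0" for z using fun_cong[OF zero, of z] by (simp only: zero_fun_apply)
    then have "z * P z = (\<Sum>k<n+2. a k * Q k (n + 1) z)
        + (\<Sum>k<n+1. b k * Q k n z) + (\<Sum>k<n. c k * Q k (n - 1) z)" for z
      using Suc by (simp add: F_def algebra_simps)
    then show ?thesis
      by (intro exI[of _ a] exI[of _ b] exI[of _ c] allI)
  qed
qed


section \<open>The three-term relation\<close>

lemma Qvec_conj_sym:
  assumes "Qvec Q (int n) z = backward_id (n + 1) *\<^sub>v map_vec cnj (Qvec Q (int n) z)" and "k \<le> n"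
  shows "Q k n z = cnj (Q (n - k) n z)"
proof -
  have "Qvec Q (int n) z $ k = (backward_id (n + 1) *\<^sub>v map_vec cnj (Qvec Q (int n) z)) $ k"
    using assms(1) by (rule arg_cong)
  also have "\<dots> = (\<Sum>l\<in>{0..<n+1}. (if k + l + 1 = n + 1 then 1 else 0) * cnj (Q l n z))"
    using assms(2)
    by (simp add: backward_id_def Qvec_def scalar_prod_def nat_add_distrib del: sum.op_ivl_Suc)
  also have "\<dots> = (\<Sum>l\<in>{0..<n+1}. if l = n - k then cnj (Q l n z) else 0)"
    using assms(2) by (intro sum.cong) auto
  also have "\<dots> = cnj (Q (n - k) n z)"
    by (simp del: sum.op_ivl_Suc)
  finally show ?thesis using assms(2) by (simp add: Qvec_def nat_add_distrib)
qed

text \<open>Multiplying by a backward identity on the left reverses the rows, on the right the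
  columns.\<close>

lemma backward_id_conjugate:
  assumes "A \<in> carrier_mat m n" and "i < n" and "j < m"
  shows "(backward_id n * transpose_mat A * backward_id m) $$ (i, j) = A $$ (m - 1 - j, n - 1 - i)"
proof -
  have left: "(backward_id n * transpose_mat A) $$ (i, l) = A $$ (l, n - 1 - i)" if "l < m" for l
  proof -
    have "(backward_id n * transpose_mat A) $$ (i, l) =
        (\<Sum>k\<in>{0..<n}. (if i + k + 1 = n then 1 else 0) * A $$ (l, k))"
      using assms that by (simp add: backward_id_def scalar_prod_def)
    also have "\<dots> = (\<Sum>k\<in>{0..<n}. if k = n - 1 - i then A $$ (l, k) else 0)"
      using assms by (intro sum.cong) auto
    also have "\<dots> = A $$ (l, n - 1 - i)" using assms by simp
    finally show ?thesis .
  qed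
  have "(backward_id n * transpose_mat A * backward_id m) $$ (i, j) =
      (\<Sum>l\<in>{0..<m}. (backward_id n * transpose_mat A) $$ (i, l) * (if l + j + 1 = m then 1 else 0))"
    using assms by (simp add: backward_id_def scalar_prod_def)
  also have "\<dots> = (\<Sum>l\<in>{0..<m}. if l = m - 1 - j then A $$ (l, n - 1 - i) else 0)"
    using assms left by (intro sum.cong) auto
  also have "\<dots> = A $$ (m - 1 - j, n - 1 - i)" using assms by simp
  finally show ?thesis .
qed

lemma mat_mult_Qvec:
  "mat r (nat (m + 1)) (\<lambda>(i, k). c i k) *\<^sub>v Qvec Q m z =
    vec r (\<lambda>i. \<Sum>k<nat (m + 1). c i k * Q k (nat m) z)"
  by (rule eq_vecI) (simp_all add: Qvec_def scalar_prod_def lessThan_atLeast0)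

lemma VC_mem_facts:
  assumes "P \<in> VC \<Omega> W n"
  shows "polynomial_parts P" and "m < n \<Longrightarrow> R \<in> VC \<Omega> W m \<Longrightarrow> ipC \<Omega> W P R = 0"
    and "m < n \<Longrightarrow> R \<in> VC \<Omega> W m \<Longrightarrow> ipC \<Omega> W R P = 0"
proof -
  show "polynomial_parts P" using assms PiC_polynomial_parts by (auto simp: VC_def)
  show orth: "ipC \<Omega> W P R = 0" if "m < n" "R \<in> VC \<Omega> W m"
    using assms that PiC_mono[of "int m" "int n - 1"] by (auto simp: VC_def)
  then show "ipC \<Omega> W R P = 0" if "m < n" "R \<in> VC \<Omega> W m"
    using that ipC_zero_sym by metis
qed

theorem theorem5p1:
  fixes \<Omega> :: "(real \<times> real) set"
    and W :: "real \<times> real \<Rightarrow> real"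
    and Q :: "nat \<Rightarrow> nat \<Rightarrow> complex \<Rightarrow> complex"
  assumes weight: "admissible_weight \<Omega> W"
    and basis: "\<And>n. basis_family n (\<lambda>k. Q k n) (VC \<Omega> W n)"
    and conj_sym: "\<And>n z. Qvec Q (int n) z = backward_id (n + 1) *\<^sub>v map_vec cnj (Qvec Q (int n) z)"
    and Q0: "\<And>z. Q 0 0 z = 1"
  shows "\<exists>(\<alpha> :: nat \<Rightarrow> complex mat) (\<beta> :: nat \<Rightarrow> complex mat) (\<gamma> :: int \<Rightarrow> complex mat).
    (\<forall>n. \<alpha> n \<in> carrier_mat (n + 1) (n + 2) \<and> \<beta> n \<in> carrier_mat (n + 1) (n + 1) \<and>
         \<gamma> (int n - 1) \<in> carrier_mat (n + 1) n) \<and>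
    (\<forall>n z. z \<cdot>\<^sub>v Qvec Q (int n) z =
         \<alpha> n *\<^sub>v Qvec Q (int n + 1) z + \<beta> n *\<^sub>v Qvec Q (int n) z
           + \<gamma> (int n - 1) *\<^sub>v Qvec Q (int n - 1) z) \<and>
    (\<forall>n\<ge>1. \<gamma> (int n - 1) * Hmat \<Omega> W Q (n - 1) =
         backward_id (n + 1) * transpose_mat (\<alpha> (n - 1) * Hmat \<Omega> W Q n) * backward_id n)"
proof -
  have mem: "Q k n \<in> VC \<Omega> W n" if "k \<le> n" for k n
    using basis_family_mem[OF basis that] .
  have "\<forall>n i. \<exists>a b c. i \<le> n \<longrightarrow> (\<forall>z. z * Q i n z = (\<Sum>k<n+2. a k * Q k (n + 1) z)
      + (\<Sum>k<n+1. b k * Q k n z) + (\<Sum>k<n. c k * Q k (n - 1) z))"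
    using three_term_entry[OF weight basis mem] by blast
  then obtain a b c where abc: "\<And>n i z. i \<le> n \<Longrightarrow> z * Q i n z =
      (\<Sum>k<n+2. a n i k * Q k (n + 1) z)
      + (\<Sum>k<n+1. b n i k * Q k n z) + (\<Sum>k<n. c n i k * Q k (n - 1) z)"
    unfolding choice_iff by blast
  define \<alpha> where "\<alpha> n = mat (n + 1) (n + 2) (\<lambda>(i, k). a n i k)" for n
  define \<beta> where "\<beta> n = mat (n + 1) (n + 1) (\<lambda>(i, k). b n i k)" for n
  \<comment> \<open>Indexed from \<open>-1\<close>, so that index \<open>n - 1\<close> carries the coefficients of \<open>z Q\<^sub>n\<close>.\<close>
  define \<gamma> where "\<gamma> m = mat (nat (m + 1) + 1) (nat (m + 1)) (\<lambda>(i, k). c (nat (m + 1)) i k)" for m :: int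
  have carriers: "\<alpha> n \<in> carrier_mat (n + 1) (n + 2) \<and> \<beta> n \<in> carrier_mat (n + 1) (n + 1) \<and>
      \<gamma> (int n - 1) \<in> carrier_mat (n + 1) n" for n
    by (simp add: \<alpha>_def \<beta>_def \<gamma>_def)

  have three_term: "z \<cdot>\<^sub>v Qvec Q (int n) z =
      \<alpha> n *\<^sub>v Qvec Q (int n + 1) z + \<beta> n *\<^sub>v Qvec Q (int n) z
        + \<gamma> (int n - 1) *\<^sub>v Qvec Q (int n - 1) z" for n z
  proof -
    have "\<alpha> n *\<^sub>v Qvec Q (int n + 1) z = vec (n + 1) (\<lambda>i. \<Sum>k<n+2. a n i k * Q k (n + 1) z)"
      using mat_mult_Qvec[of "n + 1" "int n + 1" "a n" Q z]
      by (simp add: \<alpha>_def nat_add_distrib)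
    moreover have "\<beta> n *\<^sub>v Qvec Q (int n) z = vec (n + 1) (\<lambda>i. \<Sum>k<n+1. b n i k * Q k n z)"
      using mat_mult_Qvec[of "n + 1" "int n" "b n" Q z]
      by (simp add: \<beta>_def nat_add_distrib)
    moreover have "\<gamma> (int n - 1) *\<^sub>v Qvec Q (int n - 1) z =
        vec (n + 1) (\<lambda>i. \<Sum>k<n. c n i k * Q k (n - 1) z)"
      using mat_mult_Qvec[of "n + 1" "int n - 1" "c n" Q z]
      by (simp add: \<gamma>_def nat_diff_distrib)
    moreover have "z \<cdot>\<^sub>v Qvec Q (int n) z = vec (n + 1) (\<lambda>i. z * Q i n z)"
      by (rule eq_vecI) (simp_all add: Qvec_def nat_add_distrib)
    ultimately show ?thesis
      by (intro eq_vecI) (simp_all add: abc del: sum.lessThan_Suc)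
  qed

  have relation: "\<gamma> (int n - 1) * Hmat \<Omega> W Q (n - 1) =
      backward_id (n + 1) * transpose_mat (\<alpha> (n - 1) * Hmat \<Omega> W Q n) * backward_id n"
    if n: "n \<ge> 1" for n
  proof -
    obtain m where m: "n = Suc m" using n by (cases n) auto
    have poly: "polynomial_parts (Q k l)" if "k \<le> l" for k l
      using VC_mem_facts(1)[OF mem[OF that]] .
    have orth: "ipC \<Omega> W (Q k l) (Q k' l') = 0" if "k \<le> l" "k' \<le> l'" "l \<noteq> l'" for k l k' l'
      using VC_mem_facts(2)[OF mem[OF that(1)], of l' "Q k' l'"]
        VC_mem_facts(3)[OF mem[OF that(2)], of l "Q k l"] mem that by (metis nat_neq_iff)
    have expand: "ipC \<Omega> W (\<lambda>z. z * Q i l z) (Q j p) =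
        (\<Sum>k<l+2. a l i k * ipC \<Omega> W (Q k (l + 1)) (Q j p))
        + (\<Sum>k<l+1. b l i k * ipC \<Omega> W (Q k l) (Q j p))
        + (\<Sum>k<l. c l i k * ipC \<Omega> W (Q k (l - 1)) (Q j p))" if "i \<le> l" "j \<le> p" for i l j p
    proof -
      have sum_poly: "polynomial_parts (\<lambda>z. \<Sum>k<r. d k * Q k s z)" if "r \<le> s + 1" for r s d
        using that
        by (intro polynomial_parts_sum polynomial_parts_mult polynomial_parts_const poly) auto
      have ip_sum: "ipC \<Omega> W (\<lambda>z. \<Sum>k<r. d k * Q k s z) (Q j p) =
          (\<Sum>k<r. d k * ipC \<Omega> W (Q k s) (Q j p))" if "r \<le> s + 1" for r s d
        using that \<open>j \<le> p\<close> by (intro ipC_sum_left[OF weight] poly) auto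
      have add3: "ipC \<Omega> W (\<lambda>z. f z + g z + h z) (Q j p) =
          ipC \<Omega> W f (Q j p) + ipC \<Omega> W g (Q j p) + ipC \<Omega> W h (Q j p)"
        if "polynomial_parts f" "polynomial_parts g" "polynomial_parts h" for f g h
        using that by (simp add: ipC_add_left[OF weight _ _ poly[OF \<open>j \<le> p\<close>]] polynomial_parts_add)
      have "ipC \<Omega> W (\<lambda>z. z * Q i l z) (Q j p) = ipC \<Omega> W (\<lambda>z. (\<Sum>k<l+2. a l i k * Q k (l + 1) z)
          + (\<Sum>k<l+1. b l i k * Q k l z) + (\<Sum>k<l. c l i k * Q k (l - 1) z)) (Q j p)"
        using abc[OF that(1)] by presburger
      also have "\<dots> = ipC \<Omega> W (\<lambda>z. \<Sum>k<l+2. a l i k * Q k (l + 1) z) (Q j p)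
          + ipC \<Omega> W (\<lambda>z. \<Sum>k<l+1. b l i k * Q k l z) (Q j p)
          + ipC \<Omega> W (\<lambda>z. \<Sum>k<l. c l i k * Q k (l - 1) z) (Q j p)"
        by (intro add3 sum_poly) auto
      also have "\<dots> = (\<Sum>k<l+2. a l i k * ipC \<Omega> W (Q k (l + 1)) (Q j p))
          + (\<Sum>k<l+1. b l i k * ipC \<Omega> W (Q k l) (Q j p))
          + (\<Sum>k<l. c l i k * ipC \<Omega> W (Q k (l - 1)) (Q j p))"
        by (intro arg_cong2[of _ _ _ _ "(+)"] ip_sum) auto
      finally show ?thesis .
    qed
    \<comment> \<open>In each of the next two expansions orthogonality leaves the sum over the basis of the degree
      that is paired with; that sum is an entry of a matrix product with the Gram matrix.\<close>
    have lower: "(\<gamma> (int n - 1) * Hmat \<Omega> W Q m) $$ (i, j) = ipC \<Omega> W (\<lambda>z. z * Q i n z) (Q j m)"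
      if ij: "i \<le> n" "j \<le> m" for i j
    proof -
      have "ipC \<Omega> W (\<lambda>z. z * Q i n z) (Q j m) = (\<Sum>k<n. c n i k * ipC \<Omega> W (Q k m) (Q j m))"
        using expand[OF ij] ij m by (simp add: orth del: sum.lessThan_Suc)
      then show ?thesis
        using ij m
        by (simp add: \<gamma>_def Hmat_def scalar_prod_def lessThan_atLeast0 nat_add_distrib
            del: sum.op_ivl_Suc)
    qed
    have upper: "(\<alpha> m * Hmat \<Omega> W Q n) $$ (i, j) = ipC \<Omega> W (\<lambda>z. z * Q i m z) (Q j n)"
      if ij: "i \<le> m" "j \<le> n" for i j
    proof -
      have "ipC \<Omega> W (\<lambda>z. z * Q i m z) (Q j n) = (\<Sum>k<n+1. a m i k * ipC \<Omega> W (Q k n) (Q j n))"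
        using expand[OF ij] ij m by (simp add: orth del: sum.lessThan_Suc)
      then show ?thesis
        using ij m
        by (simp add: \<alpha>_def Hmat_def scalar_prod_def lessThan_atLeast0 del: sum.op_ivl_Suc)
    qed
    \<comment> \<open>The integrands agree pointwise once each basis polynomial is written as the conjugate of its
      mirror image.\<close>
    have swap: "ipC \<Omega> W (\<lambda>z. z * Q i n z) (Q j m) = ipC \<Omega> W (\<lambda>z. z * Q (m - j) m z) (Q (n - i) n)"
      if ij: "i \<le> n" "j \<le> m" for i j
    proof -
      have i: "Q i n z = cnj (Q (n - i) n z)" for z
        by (rule Qvec_conj_sym[OF conj_sym ij(1)])
      have "Q j m z = cnj (Q (m - j) m z)" for z
        by (rule Qvec_conj_sym[OF conj_sym ij(2)])
      then have j: "cnj (Q j m z) = Q (m - j) m z" for z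
        by (simp only: complex_cnj_cnj)
      show ?thesis unfolding ipC_def i j by (simp only: mult_ac)
    qed
    have A: "\<alpha> m * Hmat \<Omega> W Q n \<in> carrier_mat n (n + 1)"
      by (rule mult_carrier_mat[of _ _ "n + 1"]) (use m in \<open>simp_all add: \<alpha>_def Hmat_def\<close>)
    have "\<gamma> (int n - 1) * Hmat \<Omega> W Q m =
        backward_id (n + 1) * transpose_mat (\<alpha> m * Hmat \<Omega> W Q n) * backward_id n"
    proof (rule eq_matI)
      fix i j
      assume "i < dim_row (backward_id (n + 1) * transpose_mat (\<alpha> m * Hmat \<Omega> W Q n) * backward_id n)"
        and "j < dim_col (backward_id (n + 1) * transpose_mat (\<alpha> m * Hmat \<Omega> W Q n) * backward_id n)"
      then have ij: "i \<le> n" "j \<le> m" using m by (auto simp: backward_id_def)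
      then show "(\<gamma> (int n - 1) * Hmat \<Omega> W Q m) $$ (i, j) =
          (backward_id (n + 1) * transpose_mat (\<alpha> m * Hmat \<Omega> W Q n) * backward_id n) $$ (i, j)"
        using backward_id_conjugate[OF A, of i j] m lower[OF ij] swap[OF ij] upper[of "m - j" "n - i"]
        by simp
    qed (use m in \<open>simp_all add: \<gamma>_def Hmat_def backward_id_def\<close>)
    then show ?thesis using m by simp
  qed

  show ?thesis
    by (intro exI[of _ \<alpha>] exI[of _ \<beta>] exI[of _ \<gamma>] conjI allI impI)
       (use carriers three_term relation in auto)
qed

end
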